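(* (i) If $x$ solves $(PP)$, then $\lambda=\mathrm{sgn}(A_{\pi_1}x)$ solves $(DP)$. (ii) If $\lambda$ solves $(DP)$, then $x=\frac{1}{2}\bigl(A_{\pi_1}^T\lambda+(n+1)\mathbf{1}_{n^2}\bigr)$ solves $(PP)$.
   Context: Let $n\ge 2$ be an integer and $s(m)=\sum_{i=1}^{m-1} i$. Define matrices $A(m)$ with $s(m)$ rows and $m$ columns recursively: $A(1)$ is the empty matrix, and for $m\ge 2$, $A(m)=\begin{pmatrix}\mathbf{1}_{m-1} & -U_{m-1}\\ \mathbf{0}_{s(m-1)} & A(m-1)\end{pmatrix}$, where $\mathbf{1}_{m-1}$ is the column vector of $m-1$ ones, $U_{m-1}$ is the identity matrix and $\mathbf{0}_{s(m-1)}$ is the zero column vector of length $s(m-1)$. Let $A$ be the $n\,s(n)\times n^2$ block-diagonal matrix with $n$ copies of $A(n)$ on its diagonal and zeros elsewhere. For a permutation $\pi$ of $\{1,\dots,n^2\}$ let $A_\pi=(a^{\pi^{-1}(1)},\dots,a^{\pi^{-1}(n^2)})$, where $a^j$ is the $j$-th column of $A$. For $y\in\mathbb{Z}^s$ write $y<>\mathbf{0}$ if every component of $y$ is nonzero; for such $y$, $\mathrm{sgn}(y)$ is the componentwise sign vector. $\mathbf 1_m$ is the vector of $m$ ones. Fix permutations $\pi_1,\pi_2,\pi_3$ of $\{1,\dots,n^2\}$, an integer $0\le k\le n^2$, an index set $\{i_1,\dots,i_k\}\subset\{1,\dots,n^2\}$ and integers $g_{i_1},\dots,g_{i_k}$ with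 $1\le g_{i_l}\le n$. Let $g=(g_{i_1},\dots,g_{i_k})^T$ and let $A_{eq}$ be the $k\times n^2$ matrix whose $l$-th row is the $i_l$-th row of the $n^2\times n^2$ identity matrix, so $[A_{eq}x]_l=x_{i_l}$. $x$ solves the primal problem $(PP)$ if $x=(x_1,\dots,x_{n^2})^T\in\mathbb{Z}^{n^2}$, $1\le x_i\le n$ for all $i$, $A_{\pi_r}x<>\mathbf{0}$ for $r=1,2,3$, and $A_{eq}x=g$. $\lambda$ solves the dual problem $(DP)$ if $\lambda\in\{-1,+1\}^{n\cdot s(n)}$, $A_{\pi_r}A_{\pi_1}^T\lambda<>\mathbf{0}$ for $r=1,2,3$, and $A_{eq}A_{\pi_1}^T\lambda=2g-(n+1)\mathbf{1}_k$. *)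

theory Defs
  imports Complex_Main "HOL-Combinatorics.Permutations" "Jordan_Normal_Form.Matrix"
begin

text \<open>
  All matrices and vectors are real, and integrality of a vector is an explicit condition. In this
  way the vector with the factor 1/2 in the theorem can be written down before it is known to be
  integral. Permutations and the indices \<open>i\<^sub>l\<close> live on \<open>{1..n\<^sup>2}\<close>, whereas rows, columns and
  components of \<open>mat\<close> and \<open>vec\<close> are counted from 0; hence the shifts by one.
\<close>

definition s_sum :: "nat \<Rightarrow> nat" where
  "s_sum m = (\<Sum>i = 1..<m. i)"

definition ones :: "nat \<Rightarrow> real vec" where
  "ones m = vec m (\<lambda>_. 1)"

text \<open>The value at 0 is a dummy; the recursion starts with the \<open>0 \<times> 1\<close> matrix at 1.\<close>

fun A_blk :: "nat \<Rightarrow> real mat" where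
  "A_blk 0 = 0\<^sub>m 0 0"
| "A_blk (Suc 0) = 0\<^sub>m 0 1"
| "A_blk (Suc (Suc m)) =
     four_block_mat (mat_of_cols (Suc m) [ones (Suc m)]) (- 1\<^sub>m (Suc m))
                    (0\<^sub>m (s_sum (Suc m)) 1)                  (A_blk (Suc m))"

definition A_mat :: "nat \<Rightarrow> real mat" where
  "A_mat n = diag_block_mat (replicate n (A_blk n))"

text \<open>\<open>inv_into UNIV p\<close> is the inverse permutation; the notation \<open>inv\<close> is taken by HOL-Algebra here.\<close>

definition A_perm :: "nat \<Rightarrow> (nat \<Rightarrow> nat) \<Rightarrow> real mat" where
  "A_perm n p = mat_of_cols (n * s_sum n) (map (\<lambda>j. col (A_mat n) (inv_into UNIV p j - 1)) [1..<n\<^sup>2 + 1])"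

definition no_zero_entry :: "real vec \<Rightarrow> bool" where
  "no_zero_entry y \<longleftrightarrow> (\<forall>j < dim_vec y. y $ j \<noteq> 0)"

definition A_eq :: "nat \<Rightarrow> nat \<Rightarrow> (nat \<Rightarrow> nat) \<Rightarrow> real mat" where
  "A_eq n k i = mat_of_rows (n\<^sup>2) (map (\<lambda>l. row (1\<^sub>m (n\<^sup>2)) (i l - 1)) [1..<k + 1])"

text \<open>The vector \<open>(g\<^bsub>i\<^sub>1\<^esub>, \<dots>, g\<^bsub>i\<^sub>k\<^esub>)\<close>; the function \<open>g\<close> takes the indices \<open>i\<^sub>l\<close> themselves as arguments.\<close>

definition g_vec :: "nat \<Rightarrow> (nat \<Rightarrow> nat) \<Rightarrow> (nat \<Rightarrow> int) \<Rightarrow> real vec" where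
  "g_vec k i g = vec_of_list (map (\<lambda>l. of_int (g (i l))) [1..<k + 1])"

definition solves_PP ::
    "nat \<Rightarrow> (nat \<Rightarrow> nat \<Rightarrow> nat) \<Rightarrow> nat \<Rightarrow> (nat \<Rightarrow> nat) \<Rightarrow> (nat \<Rightarrow> int) \<Rightarrow> real vec \<Rightarrow> bool" where
  "solves_PP n \<pi> k i g x \<longleftrightarrow>
     x \<in> carrier_vec (n\<^sup>2) \<and>
     (\<forall>j < n\<^sup>2. x $ j \<in> \<int> \<and> 1 \<le> x $ j \<and> x $ j \<le> real n) \<and>
     (\<forall>r \<in> {1, 2, 3}. no_zero_entry (A_perm n (\<pi> r) *\<^sub>v x)) \<and>
     A_eq n k i *\<^sub>v x = g_vec k i g"

definition solves_DP ::
    "nat \<Rightarrow> (nat \<Rightarrow> nat \<Rightarrow> nat) \<Rightarrow> nat \<Rightarrow> (nat \<Rightarrow> nat) \<Rightarrow> (nat \<Rightarrow> int) \<Rightarrow> real vec \<Rightarrow> bool" where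
  "solves_DP n \<pi> k i g lam \<longleftrightarrow>
     lam \<in> carrier_vec (n * s_sum n) \<and>
     (\<forall>j < n * s_sum n. lam $ j \<in> {-1, 1}) \<and>
     (\<forall>r \<in> {1, 2, 3}. no_zero_entry ((A_perm n (\<pi> r) * (A_perm n (\<pi> 1))\<^sup>T) *\<^sub>v lam)) \<and>
     (A_eq n k i * (A_perm n (\<pi> 1))\<^sup>T) *\<^sub>v lam
       = 2 \<cdot>\<^sub>v g_vec k i g - (real n + 1) \<cdot>\<^sub>v ones k"

end

theory Submission
  imports Defs
begin

text \<open>
  Every row of \<open>A\<^bsub>\<pi>\<^esub>\<close> is \<open>e\<^sub>u - e\<^sub>v\<close>, and the pairs \<open>(u, v)\<close> orient the edges of a disjoint union of \<open>n\<close>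
  complete graphs on \<open>n\<close> vertices each. If \<open>A\<^bsub>\<pi>\<^esub> x\<close> has no zero entry and the entries of \<open>x\<close> lie in
  \<open>{1..n}\<close>, then \<open>x\<close> takes every value \<open>1, \<dots>, n\<close> exactly once on each complete graph. Hence entry \<open>c\<close>
  of \<open>A\<^bsub>\<pi>\<^esub>\<^sup>T sgn (A\<^bsub>\<pi>\<^esub> x)\<close>, which is the sum of \<open>sgn (x\<^sub>c - x\<^sub>d)\<close> over the neighbours \<open>d\<close> of \<open>c\<close>, equals
  \<open>(x\<^sub>c - 1) - (n - x\<^sub>c) = 2 x\<^sub>c - (n + 1)\<close>. Conversely every entry of \<open>A\<^bsub>\<pi>\<^esub>\<^sup>T \<lambda>\<close> is a sum of \<open>n - 1\<close> signs,
  so the shifted and halved vector is integral with entries in \<open>{1..n}\<close>. Since all rows of the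
  matrices sum to zero, the affine substitution does not affect the conditions \<open><> 0\<close>.
\<close>

section \<open>Edge-vertex incidence matrices of directed graphs\<close>

text \<open>This is the transposed incidence matrix of a digraph on \<open>{..<m}\<close>, with
  entry 1 at the first end and -1 at the second. Edges form a list because the order of the rows
  matters.\<close>

definition edge_mat :: "nat \<Rightarrow> (nat \<times> nat) list \<Rightarrow> real mat" where
  "edge_mat m L = mat (length L) m (\<lambda>(r, c). of_bool (c = fst (L ! r)) - of_bool (c = snd (L ! r)))"

lemma edge_mat_carrier [simp]: "edge_mat m L \<in> carrier_mat (length L) m"
  by (simp add: edge_mat_def)

lemma dim_edge_mat [simp]: "dim_row (edge_mat m L) = length L" "dim_col (edge_mat m L) = m"
  by (simp_all add: edge_mat_def)

lemma index_edge_mat: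
  "r < length L \<Longrightarrow> c < m \<Longrightarrow>
   edge_mat m L $$ (r, c) = of_bool (c = fst (L ! r)) - of_bool (c = snd (L ! r))"
  by (simp add: edge_mat_def)

lemma edge_mat_mult_vec:
  assumes "set L \<subseteq> {..<m} \<times> {..<m}" "x \<in> carrier_vec m" "r < length L"
  shows "(edge_mat m L *\<^sub>v x) $ r = x $ fst (L ! r) - x $ snd (L ! r)"
proof -
  have *: "fst (L ! r) < m" "snd (L ! r) < m"
    using subsetD[OF assms(1) nth_mem[OF assms(3)]] by (auto simp: mem_Times_iff)
  have "(edge_mat m L *\<^sub>v x) $ r =
      (\<Sum>c = 0..<m. (of_bool (c = fst (L ! r)) - of_bool (c = snd (L ! r))) * x $ c)"
    using assms by (auto simp: scalar_prod_def index_edge_mat intro!: sum.cong)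
  also have "\<dots> = (\<Sum>c = 0..<m. if c = fst (L ! r) then x $ c else 0) -
      (\<Sum>c = 0..<m. if c = snd (L ! r) then x $ c else 0)"
    by (subst sum_subtractf[symmetric]) (auto intro!: sum.cong simp: left_diff_distrib)
  also have "\<dots> = x $ fst (L ! r) - x $ snd (L ! r)"
    using * by simp
  finally show ?thesis .
qed

text \<open>Each entry is a difference of two components, so \<beta> cancels and \<alpha> only
  rescales.\<close>

lemma no_zero_entry_edge_mat_affine:
  assumes "set L \<subseteq> {..<m} \<times> {..<m}" "x \<in> carrier_vec m" "y \<in> carrier_vec m" "\<alpha> \<noteq> 0"
    and "\<And>c. c < m \<Longrightarrow> y $ c = \<alpha> * x $ c + \<beta>"
  shows "no_zero_entry (edge_mat m L *\<^sub>v y) \<longleftrightarrow> no_zero_entry (edge_mat m L *\<^sub>v x)"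
proof -
  have "(edge_mat m L *\<^sub>v y) $ r = \<alpha> * (edge_mat m L *\<^sub>v x) $ r" if "r < length L" for r
  proof -
    have "fst (L ! r) < m" "snd (L ! r) < m"
      using subsetD[OF assms(1) nth_mem[OF that]] by (auto simp: mem_Times_iff)
    then show ?thesis
      using assms that by (simp add: edge_mat_mult_vec right_diff_distrib del: index_mult_mat_vec)
  qed
  then show ?thesis
    using assms(4) by (auto simp: no_zero_entry_def simp del: index_mult_mat_vec)
qed

section \<open>Sums of signs\<close>

text \<open>The witness \<open>t\<close> counts the elements of \<open>S\<close> on which
  \<open>f\<close> is 1.\<close>

lemma sum_signs:
  fixes f :: "'a \<Rightarrow> real"
  assumes "finite S" "\<And>x. x \<in> S \<Longrightarrow> f x \<in> {-1, 1}"
  shows "\<exists>t \<le> card S. sum f S = 2 * real t - real (card S)"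
  using assms
proof (induction S rule: finite_induct)
  case (insert a S)
  then obtain t where t: "t \<le> card S" "sum f S = 2 * real t - real (card S)"
    by auto
  have "f a = -1 \<or> f a = 1"
    using insert by auto
  then show ?case
  proof
    assume "f a = -1"
    then show ?thesis
      using t insert by (intro exI[of _ t]) auto
  next
    assume "f a = 1"
    then show ?thesis
      using t insert by (intro exI[of _ "Suc t"]) auto
  qed
qed simp

text \<open>There are y - 1 values below y and n - y above it, and t = y contributes 0.\<close>

lemma sum_sgn_diff:
  assumes "y \<in> {1..n}"
  shows "(\<Sum>t = 1..n. sgn (real y - real t)) = 2 * real y - (real n + 1)"
proof -
  have "(\<Sum>t = 1..n. sgn (real y - real t)) =
      (\<Sum>t = 1..n. of_bool (t < y)) - (\<Sum>t = 1..n. of_bool (y < t))"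
    by (subst sum_subtractf[symmetric]) (auto intro!: sum.cong simp: sgn_if)
  also have "(\<Sum>t = 1..n. of_bool (t < y)) = real (card ({1..n} \<inter> {t. t < y}))"
    by (simp add: sum_of_bool_eq)
  also have "{1..n} \<inter> {t. t < y} = {1..<y}"
    using assms by auto
  also have "(\<Sum>t = 1..n. of_bool (y < t)) = real (card ({1..n} \<inter> {t. y < t}))"
    by (simp add: sum_of_bool_eq)
  also have "{1..n} \<inter> {t. y < t} = {y<..n}"
    using assms by auto
  finally show ?thesis
    using assms by (auto simp: of_nat_diff)
qed

lemma of_nat_nat_floor: "x \<in> \<int> \<Longrightarrow> 0 \<le> x \<Longrightarrow> real (nat \<lfloor>x\<rfloor>) = x"
  by (elim Ints_cases) simp

section \<open>Disjoint unions of tournaments on \<open>n\<close> vertices\<close>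

text \<open>The classes of \<open>cls\<close> are the vertex sets of the tournaments.
  \<open>distinct_edges\<close> and \<open>asym\<close> together give each edge exactly one row. The
  labelling \<open>cls\<close> is kept abstract so that the structure survives a permutation of the
  columns.\<close>

locale block_tournament =
  fixes L :: "(nat \<times> nat) list" and m n :: nat and cls :: "nat \<Rightarrow> nat"
  assumes distinct_edges: "distinct L"
    and edge_iff: "(a, b) \<in> set L \<or> (b, a) \<in> set L \<longleftrightarrow> a < m \<and> b < m \<and> a \<noteq> b \<and> cls a = cls b"
    and asym: "(a, b) \<in> set L \<Longrightarrow> (b, a) \<notin> set L"
    and card_class: "c < m \<Longrightarrow> card {d. d < m \<and> cls d = cls c} = n"
begin

definition nbrs :: "nat \<Rightarrow> nat set" where
  "nbrs c = {d. d < m \<and> cls d = cls c} - {c}"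

definition incident :: "nat \<Rightarrow> nat set" where
  "incident c = {r. r < length L \<and> (fst (L ! r) = c \<or> snd (L ! r) = c)}"

definition other_end :: "nat \<Rightarrow> nat \<Rightarrow> nat" where
  "other_end c r = (if fst (L ! r) = c then snd (L ! r) else fst (L ! r))"

lemma edges_subset: "set L \<subseteq> {..<m} \<times> {..<m}"
  using edge_iff by (metis SigmaI lessThan_iff subrelI)

lemma edge_ends:
  assumes "r < length L"
  shows "fst (L ! r) < m" "snd (L ! r) < m" "fst (L ! r) \<noteq> snd (L ! r)"
    "cls (fst (L ! r)) = cls (snd (L ! r))"
  using edge_iff[of "fst (L ! r)" "snd (L ! r)"] nth_mem[OF assms] by auto

lemma finite_incident [simp]: "finite (incident c)"
  by (simp add: incident_def)

text \<open>Each neighbour of \<open>c\<close> is joined to \<open>c\<close> by exactly one row, so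
  sums over rows through \<open>c\<close> can be rewritten as sums over neighbours.\<close>

lemma bij_betw_other_end:
  assumes "c < m"
  shows "bij_betw (other_end c) (incident c) (nbrs c)"
proof (rule bij_betw_imageI)
  have edge_cases: "L ! r = (c, other_end c r) \<or> L ! r = (other_end c r, c)"
    if "r \<in> incident c" for r
    using that by (cases "L ! r") (auto simp: incident_def other_end_def)
  show "inj_on (other_end c) (incident c)"
  proof (rule inj_onI)
    fix r r' assume r: "r \<in> incident c" and r': "r' \<in> incident c"
      and eq: "other_end c r = other_end c r'"
    have len: "r < length L" "r' < length L"
      using r r' by (auto simp: incident_def)
    have "L ! r \<in> set L" "L ! r' \<in> set L"
      using len by auto
    \<comment> \<open>Two rows with the same ends could differ only by being reversed, which
      \<open>asym\<close> excludes.\<close>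
    then have "L ! r = L ! r'"
      using edge_cases[OF r] edge_cases[OF r'] asym eq by metis
    then show "r = r'"
      using distinct_edges len by (simp add: nth_eq_iff_index_eq)
  qed
  show "other_end c ` incident c = nbrs c"
  proof (intro equalityI subsetI)
    fix d assume "d \<in> other_end c ` incident c"
    then show "d \<in> nbrs c"
    proof (elim imageE)
      fix r assume "d = other_end c r" "r \<in> incident c"
      then show "d \<in> nbrs c"
        using edge_ends[of r] by (auto simp: incident_def nbrs_def other_end_def split: if_splits)
    qed
  next
    fix d assume "d \<in> nbrs c"
    then have "(c, d) \<in> set L \<or> (d, c) \<in> set L"
      using edge_iff[of c d] assms by (auto simp: nbrs_def)
    then obtain r where "r < length L"
      "fst (L ! r) = c \<and> snd (L ! r) = d \<or> fst (L ! r) = d \<and> snd (L ! r) = c"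
      by (metis fst_conv in_set_conv_nth snd_conv)
    then show "d \<in> other_end c ` incident c"
      by (intro image_eqI[of _ _ r]) (auto simp: incident_def other_end_def)
  qed
qed

lemma card_incident:
  assumes "c < m"
  shows "Suc (card (incident c)) = n"
proof -
  have "card (incident c) = card (nbrs c)"
    using bij_betw_other_end[OF assms] by (rule bij_betw_same_card)
  moreover have "Suc (card (nbrs c)) = card {d. d < m \<and> cls d = cls c}"
    unfolding nbrs_def using assms by (intro card_Suc_Diff1) auto
  ultimately show ?thesis
    using card_class[OF assms] by simp
qed

lemma transpose_edge_mat_mult_vec:
  assumes "lam \<in> carrier_vec (length L)" "c < m"
  shows "((edge_mat m L)\<^sup>T *\<^sub>v lam) $ c =
    (\<Sum>r \<in> incident c. (if fst (L ! r) = c then 1 else -1) * lam $ r)"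
proof -
  have "((edge_mat m L)\<^sup>T *\<^sub>v lam) $ c =
      (\<Sum>r = 0..<length L. (of_bool (c = fst (L ! r)) - of_bool (c = snd (L ! r))) * lam $ r)"
    using assms by (auto simp: scalar_prod_def index_edge_mat intro!: sum.cong)
  also have "\<dots> = (\<Sum>r \<in> incident c. (if fst (L ! r) = c then 1 else -1) * lam $ r)"
    \<comment> \<open>Rows avoiding \<open>c\<close> have coefficient 0. The absence of loops makes
      the other coefficients 1 or -1.\<close>
    by (rule sum.mono_neutral_cong_right) (use edge_ends in \<open>auto simp: incident_def\<close>)
  finally show ?thesis .
qed

text \<open>Every vertex has degree n - 1, so the entry is a sum of n - 1 signs and
  \<open>sum_signs\<close> gives 2t - (n - 1).\<close>

lemma transpose_mult_signs:
  assumes "lam \<in> carrier_vec (length L)" "\<And>r. r < length L \<Longrightarrow> lam $ r \<in> {-1, 1}" "c < m"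
  shows "\<exists>t < n. ((edge_mat m L)\<^sup>T *\<^sub>v lam) $ c = 2 * real t + 1 - real n"
proof -
  have "\<exists>t \<le> card (incident c). ((edge_mat m L)\<^sup>T *\<^sub>v lam) $ c = 2 * real t - card (incident c)"
    unfolding transpose_edge_mat_mult_vec[OF assms(1,3)]
  proof (rule sum_signs)
    fix r assume "r \<in> incident c"
    then show "(if fst (L ! r) = c then 1 else -1) * lam $ r \<in> {-1, 1}"
      using assms(2)[of r] by (auto simp: incident_def)
  qed simp
  then obtain t where "t \<le> card (incident c)"
    "((edge_mat m L)\<^sup>T *\<^sub>v lam) $ c = 2 * real t - real (card (incident c))"
    by blast
  then show ?thesis
    using card_incident[OF assms(3)] by (intro exI[of _ t]) auto
qed

text \<open>Any two vertices of a class are joined by a row, so a nonzero product forces distinct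
  values within the class. Then n distinct values in \<open>{1..n}\<close> exhaust that set. The
  floor turns the integral reals into natural numbers.\<close>

lemma class_values:
  assumes "x \<in> carrier_vec m" "\<And>j. j < m \<Longrightarrow> x $ j \<in> \<int> \<and> 1 \<le> x $ j \<and> x $ j \<le> real n"
    and "no_zero_entry (edge_mat m L *\<^sub>v x)" "c < m"
  shows "bij_betw (\<lambda>d. nat \<lfloor>x $ d\<rfloor>) {d. d < m \<and> cls d = cls c} {1..n}"
proof -
  have val: "real (nat \<lfloor>x $ d\<rfloor>) = x $ d" if "d < m" for d
    using assms(2)[OF that] by (intro of_nat_nat_floor) simp_all
  have inj: "inj_on (\<lambda>d. nat \<lfloor>x $ d\<rfloor>) {d. d < m \<and> cls d = cls c}"
  proof (rule inj_onI, rule ccontr)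
    fix a b assume a: "a \<in> {d. d < m \<and> cls d = cls c}" and b: "b \<in> {d. d < m \<and> cls d = cls c}"
      and eq: "nat \<lfloor>x $ a\<rfloor> = nat \<lfloor>x $ b\<rfloor>" and "a \<noteq> b"
    have "(a, b) \<in> set L \<or> (b, a) \<in> set L"
      using edge_iff[of a b] a b \<open>a \<noteq> b\<close> by auto
    then obtain r where "r < length L" "L ! r = (a, b) \<or> L ! r = (b, a)"
      by (auto simp: in_set_conv_nth)
    moreover have "x $ a = x $ b"
      using val[of a] val[of b] a b unfolding eq by simp
    ultimately have "r < length L" "(edge_mat m L *\<^sub>v x) $ r = 0"
      using edge_mat_mult_vec[OF edges_subset assms(1), of r] by auto
    then show False
      using assms(3) by (simp add: no_zero_entry_def del: index_mult_mat_vec)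
  qed
  moreover have "(\<lambda>d. nat \<lfloor>x $ d\<rfloor>) ` {d. d < m \<and> cls d = cls c} = {1..n}"
  proof (rule card_subset_eq)
    show "(\<lambda>d. nat \<lfloor>x $ d\<rfloor>) ` {d. d < m \<and> cls d = cls c} \<subseteq> {1..n}"
    proof (intro image_subsetI)
      fix d assume "d \<in> {d. d < m \<and> cls d = cls c}"
      then have "d < m"
        by simp
      then have "1 \<le> real (nat \<lfloor>x $ d\<rfloor>)" "real (nat \<lfloor>x $ d\<rfloor>) \<le> real n"
        unfolding val[OF \<open>d < m\<close>] using assms(2)[of d] by blast+
      then show "nat \<lfloor>x $ d\<rfloor> \<in> {1..n}"
        by simp
    qed
    show "card ((\<lambda>d. nat \<lfloor>x $ d\<rfloor>) ` {d. d < m \<and> cls d = cls c}) = card {1..n}"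
      using card_image[OF inj] card_class[OF assms(4)] by simp
  qed simp
  ultimately show ?thesis
    by (simp add: bij_betw_def)
qed

lemma transpose_mult_sgn:
  assumes "x \<in> carrier_vec m" "\<And>j. j < m \<Longrightarrow> x $ j \<in> \<int> \<and> 1 \<le> x $ j \<and> x $ j \<le> real n"
    and "no_zero_entry (edge_mat m L *\<^sub>v x)" "c < m"
  shows "((edge_mat m L)\<^sup>T *\<^sub>v map_vec sgn (edge_mat m L *\<^sub>v x)) $ c = 2 * x $ c - (real n + 1)"
proof -
  define y where "y d = nat \<lfloor>x $ d\<rfloor>" for d
  define C where "C = {d. d < m \<and> cls d = cls c}"
  have val: "real (y d) = x $ d" if "d < m" for d
    unfolding y_def using assms(2)[OF that] by (intro of_nat_nat_floor) simp_all
  have bij: "bij_betw y C {1..n}"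
    using class_values[OF assms] by (simp add: y_def[abs_def] C_def)
  have yc: "y c \<in> {1..n}"
    using bij_betw_apply[OF bij, of c] assms(4) by (simp add: C_def)
  have "((edge_mat m L)\<^sup>T *\<^sub>v map_vec sgn (edge_mat m L *\<^sub>v x)) $ c =
      (\<Sum>r \<in> incident c. (if fst (L ! r) = c then 1 else -1) * map_vec sgn (edge_mat m L *\<^sub>v x) $ r)"
    by (rule transpose_edge_mat_mult_vec[OF carrier_vecI assms(4)]) simp
  also have "\<dots> = (\<Sum>r \<in> incident c. sgn (x $ c - x $ other_end c r))"
  proof (rule sum.cong)
    fix r assume r: "r \<in> incident c"
    then have "r < length L"
      by (simp add: incident_def)
    then have *: "map_vec sgn (edge_mat m L *\<^sub>v x) $ r = sgn (x $ fst (L ! r) - x $ snd (L ! r))"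
      using edge_mat_mult_vec[OF edges_subset assms(1), of r] by (simp del: index_mult_mat_vec)
    show "(if fst (L ! r) = c then 1 else -1) * map_vec sgn (edge_mat m L *\<^sub>v x) $ r =
        sgn (x $ c - x $ other_end c r)"
      \<comment> \<open>Since sgn is odd, the factor 1 or -1 compensates for the orientation of the
        edge.\<close>
      unfolding * using r by (auto simp: incident_def other_end_def sgn_if)
  qed simp
  also have "\<dots> = (\<Sum>d \<in> nbrs c. sgn (x $ c - x $ d))"
    by (rule sum.reindex_bij_betw[OF bij_betw_other_end[OF assms(4)]])
  \<comment> \<open>The vertex \<open>c\<close> itself may join the sum, as sgn 0 = 0; then the sum
    runs over a full class and its values over \<open>{1..n}\<close>.\<close>
  also have "\<dots> = (\<Sum>d \<in> C. sgn (x $ c - x $ d))"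
    by (rule sum.mono_neutral_left) (auto simp: nbrs_def C_def)
  also have "\<dots> = (\<Sum>d \<in> C. sgn (real (y c) - real (y d)))"
    using val assms(4) by (intro sum.cong) (auto simp: C_def)
  also have "\<dots> = (\<Sum>t = 1..n. sgn (real (y c) - real t))"
    by (rule sum.reindex_bij_betw[OF bij])
  also have "\<dots> = 2 * x $ c - (real n + 1)"
    using sum_sgn_diff[OF yc] val[OF assms(4)] by simp
  finally show ?thesis .
qed

end

section \<open>The matrices of the recursion as edge matrices\<close>

text \<open>The order of the rows is that of \<open>A_blk\<close>: first the rows of (1 | -U), whose
  edges leave vertex 0, then the smaller matrix, moved by one vertex because of the zero
  column.\<close>

fun pairs :: "nat \<Rightarrow> (nat \<times> nat) list" where
  "pairs 0 = []"
| "pairs (Suc m) = map (\<lambda>b. (0, Suc b)) [0..<m] @ map (map_prod Suc Suc) (pairs m)"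

fun block_pairs :: "nat \<Rightarrow> nat \<Rightarrow> (nat \<times> nat) list" where
  "block_pairs n 0 = []"
| "block_pairs n (Suc k) = pairs n @ map (map_prod ((+) n) ((+) n)) (block_pairs n k)"

lemma set_pairs: "set (pairs m) = {(a, b). a < b \<and> b < m}"
proof (induction m)
  case (Suc m)
  have "(a, b) \<in> set (pairs (Suc m)) \<longleftrightarrow> a < b \<and> b < Suc m" for a b
    using Suc by (cases a; cases b) (auto simp: image_iff)
  then show ?case
    by auto
qed simp

lemma distinct_pairs: "distinct (pairs m)"
proof (induction m)
  case (Suc m)
  then show ?case
    by (auto simp: distinct_map prod.inj_map intro!: inj_onI)
qed simp

lemma s_sum_Suc: "s_sum (Suc m) = m + s_sum m"
  by (cases m) (simp_all add: s_sum_def)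

lemma length_pairs: "length (pairs m) = s_sum m"
  by (induction m) (simp_all add: s_sum_Suc, simp add: s_sum_def)

lemma A_blk_eq_edge_mat: "A_blk m = edge_mat m (pairs m)"
proof (induction m rule: A_blk.induct)
  case (3 m)
  let ?T = "map (\<lambda>b. (0, Suc b)) [0..<Suc m]" and ?P = "pairs (Suc m)"
  show ?case
  proof (rule eq_matI)
    fix r c
    assume rc: "r < dim_row (edge_mat (Suc (Suc m)) (pairs (Suc (Suc m))))"
      "c < dim_col (edge_mat (Suc (Suc m)) (pairs (Suc (Suc m))))"
    have len: "length ?P = s_sum (Suc m)"
      by (rule length_pairs)
    have P2: "pairs (Suc (Suc m)) = ?T @ map (map_prod Suc Suc) ?P"
      by (rule pairs.simps)
    have r: "r < Suc m + s_sum (Suc m)" and c: "c < Suc (Suc m)"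
      using rc len by (simp_all add: P2 del: pairs.simps)
    show "A_blk (Suc (Suc m)) $$ (r, c) = edge_mat (Suc (Suc m)) (pairs (Suc (Suc m))) $$ (r, c)"
    \<comment> \<open>The split on \<open>r\<close> separates the upper blocks from the lower ones;
      the later split on \<open>c\<close> separates the first column from the rest.\<close>
    proof (cases "r < Suc m")
      case True
      then show ?thesis
        using r c len 3
        by (cases c) (auto simp: P2 index_edge_mat nth_append mat_of_cols_def ones_def
            simp del: pairs.simps upt_Suc)
    next
      case False
      then show ?thesis
        using r c len 3
        by (cases c) (auto simp: P2 index_edge_mat nth_append mat_of_cols_def
            simp del: pairs.simps upt_Suc)
    qed
  qed (use 3 length_pairs[of "Suc m"] in \<open>simp_all del: pairs.simps add: pairs.simps(2)[of "Suc m"]\<close>)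
qed (auto simp: edge_mat_def)

text \<open>The ends of \<open>L\<close> lie below \<open>a\<close> and the shifted ends of
  \<open>M\<close> do not, which accounts for both zero blocks.\<close>

lemma four_block_edge_mat:
  assumes "set L \<subseteq> {..<a} \<times> {..<a}"
  shows "four_block_mat (edge_mat a L) (0\<^sub>m (length L) b) (0\<^sub>m (length M) a) (edge_mat b M) =
    edge_mat (a + b) (L @ map (map_prod ((+) a) ((+) a)) M)" (is "?F = ?E")
proof (rule eq_matI)
  fix r c assume "r < dim_row ?E" "c < dim_col ?E"
  then have rc: "r < length L + length M" "c < a + b"
    by auto
  show "?F $$ (r, c) = ?E $$ (r, c)"
  proof (cases "r < length L")
    case True
    then have "fst (L ! r) < a" "snd (L ! r) < a"
      using subsetD[OF assms nth_mem[OF True]] by (auto simp: mem_Times_iff)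
    then show ?thesis
      using True rc by (auto simp: index_edge_mat nth_append)
  next
    case False
    then show ?thesis
      using rc by (auto simp: index_edge_mat nth_append)
  qed
qed auto

lemma diag_block_edge_mat:
  "diag_block_mat (replicate k (edge_mat n (pairs n))) = edge_mat (k * n) (block_pairs n k)"
proof (induction k)
  case 0
  show ?case
    by (auto simp: edge_mat_def)
next
  case (Suc k)
  then show ?case
    by (simp add: Let_def four_block_edge_mat set_pairs subset_iff)
qed

lemma length_block_pairs: "length (block_pairs n k) = k * s_sum n"
  by (induction k) (simp_all add: length_pairs)

text \<open>The quotient by \<open>n\<close> is the index of the diagonal block that contains a
  vertex.\<close>

lemma set_block_pairs: "set (block_pairs n k) = {(a, b). a < b \<and> b < k * n \<and> a div n = b div n}"
proof (induction k)
  case (Suc k)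
  have "(a, b) \<in> set (block_pairs n (Suc k)) \<longleftrightarrow> a < b \<and> b < Suc k * n \<and> a div n = b div n" for a b
  proof -
    \<comment> \<open>Either both ends lie in the first block, or the pair comes from
      \<open>block_pairs n k\<close> by adding \<open>n\<close>; there n \<le> a < b keeps the
      subtractions exact.\<close>
    have "(a, b) \<in> set (block_pairs n (Suc k)) \<longleftrightarrow>
        a < b \<and> b < n \<or> n \<le> a \<and> a < b \<and> b < n + k * n \<and> (a - n) div n = (b - n) div n"
      by (force simp: Suc set_pairs image_iff map_prod_def le_iff_add)
    also have "\<dots> \<longleftrightarrow> a < b \<and> b < Suc k * n \<and> a div n = b div n"
    proof (cases "n = 0")
      case False
      then have lt: "u div n = 0 \<longleftrightarrow> u < n" for u
        by (simp add: div_eq_0_iff)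
      show ?thesis
      proof (cases "n \<le> a")
        case True
        then show ?thesis
          using False by (cases "a < b") (auto simp: le_div_geq)
      next
        case False
        then show ?thesis
          using lt[of a] lt[of b] by auto
      qed
    qed auto
    finally show ?thesis .
  qed
  then show ?case
    by auto
qed simp

lemma distinct_block_pairs: "distinct (block_pairs n k)"
proof (induction k)
  case (Suc k)
  have "inj_on (map_prod ((+) n) ((+) n)) (set (block_pairs n k))"
    by (rule inj_on_subset[OF prod.inj_map]) simp_all
  then show ?case
    using Suc by (auto simp: distinct_map distinct_pairs set_pairs)
qed simp

lemma block_tournament_block_pairs:
  assumes "n > 0"
  shows "block_tournament (block_pairs n k) (k * n) n (\<lambda>c. c div n)"
proof
  show "card {d. d < k * n \<and> d div n = c div n} = n" if "c < k * n" for c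
  proof -
    \<comment> \<open>The class of \<open>c\<close> is an interval of length \<open>n\<close>, which
      yields its cardinality.\<close>
    have "d div n = c div n \<longleftrightarrow> n * (c div n) \<le> d \<and> d < n * Suc (c div n)" for d
    proof
      assume "d div n = c div n"
      then show "n * (c div n) \<le> d \<and> d < n * Suc (c div n)"
        using assms dividend_less_times_div[of n d] times_div_less_eq_dividend[of n d] by simp
    next
      assume "n * (c div n) \<le> d \<and> d < n * Suc (c div n)"
      then show "d div n = c div n"
        by (intro div_nat_eqI) simp_all
    qed
    moreover have "d < k * n" if "d div n = c div n" for d
      using \<open>c < k * n\<close> that assms by (metis div_less_iff_less_mult)
    ultimately have "d < k * n \<and> d div n = c div n \<longleftrightarrow> n * (c div n) \<le> d \<and> d < n * Suc (c div n)" for d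
      by blast
    then have "{d. d < k * n \<and> d div n = c div n} = {d. n * (c div n) \<le> d \<and> d < n * Suc (c div n)}"
      by (rule Collect_cong)
    also have "\<dots> = {n * (c div n)..<n * Suc (c div n)}"
      by (simp only: atLeastLessThan_def atLeast_def lessThan_def Collect_conj_eq)
    finally show ?thesis
      by (simp only: card_atLeastLessThan mult_Suc_right diff_add_inverse2)
  qed
next
  show "(a, b) \<in> set (block_pairs n k) \<or> (b, a) \<in> set (block_pairs n k) \<longleftrightarrow>
      a < k * n \<and> b < k * n \<and> a \<noteq> b \<and> a div n = b div n" for a b
    unfolding set_block_pairs mem_Collect_eq prod.case by (metis less_trans nat_neq_iff)
qed (simp_all add: distinct_block_pairs set_block_pairs)

section \<open>Permuting the columns\<close>

text \<open>New column c is old column q c, so the old vertex u is renamed to q' u, where q' inverts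
  q on \<open>{..<m}\<close>. Permuting columns thus only renames vertices, and the classes are
  pulled back along q.\<close>

lemma (in block_tournament) relabel:
  assumes q: "bij_betw q {..<m} {..<m}" and q': "\<And>c. c < m \<Longrightarrow> q (q' c) = c \<and> q' c < m"
  shows "block_tournament (map (map_prod q' q') L) m n (cls \<circ> q)"
    and "mat (length L) m (\<lambda>(r, c). edge_mat m L $$ (r, q c)) = edge_mat m (map (map_prod q' q') L)"
proof -
  have inv: "q' (q c) = c" if "c < m" for c
    using that q q' by (metis bij_betw_def inj_on_def lessThan_iff bij_betw_apply)
  have qm: "q c < m" if "c < m" for c
    using that q bij_betw_apply by fastforce
  have mem: "(a, b) \<in> set (map (map_prod q' q') L) \<longleftrightarrow> a < m \<and> b < m \<and> (q a, q b) \<in> set L" for a b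
  proof
    assume "(a, b) \<in> set (map (map_prod q' q') L)"
    then obtain u v where "(u, v) \<in> set L" "a = q' u" "b = q' v"
      by auto
    then show "a < m \<and> b < m \<and> (q a, q b) \<in> set L"
      using edges_subset q' by auto
  next
    assume "a < m \<and> b < m \<and> (q a, q b) \<in> set L"
    then show "(a, b) \<in> set (map (map_prod q' q') L)"
      using inv by (force intro: image_eqI[of _ _ "(q a, q b)"])
  qed
  show "block_tournament (map (map_prod q' q') L) m n (cls \<circ> q)"
  proof
    have "inj_on (map_prod q' q') ({..<m} \<times> {..<m})"
      using q' by (intro map_prod_inj_on inj_onI) (metis lessThan_iff)+
    then show "distinct (map (map_prod q' q') L)"
      using distinct_edges edges_subset by (simp add: distinct_map inj_on_subset)
  next
    fix a b
    show "(a, b) \<in> set (map (map_prod q' q') L) \<or> (b, a) \<in> set (map (map_prod q' q') L) \<longleftrightarrow>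
        a < m \<and> b < m \<and> a \<noteq> b \<and> (cls \<circ> q) a = (cls \<circ> q) b"
      unfolding mem using edge_iff[of "q a" "q b"] qm inv by (metis comp_apply)
    show "(a, b) \<in> set (map (map_prod q' q') L) \<Longrightarrow> (b, a) \<notin> set (map (map_prod q' q') L)"
      unfolding mem using asym by blast
  next
    fix c assume "c < m"
    have "bij_betw q {d. d < m \<and> (cls \<circ> q) d = (cls \<circ> q) c} {d. d < m \<and> cls d = cls (q c)}"
    proof (rule bij_betw_imageI)
      show "inj_on q {d. d < m \<and> (cls \<circ> q) d = (cls \<circ> q) c}"
        using q by (auto simp: bij_betw_def intro: inj_on_subset)
      show "q ` {d. d < m \<and> (cls \<circ> q) d = (cls \<circ> q) c} = {d. d < m \<and> cls d = cls (q c)}"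
        using q' qm by (force simp: image_iff)
    qed
    then show "card {d. d < m \<and> (cls \<circ> q) d = (cls \<circ> q) c} = n"
      using card_class[OF qm[OF \<open>c < m\<close>]] by (simp add: bij_betw_same_card)
  qed
  show "mat (length L) m (\<lambda>(r, c). edge_mat m L $$ (r, q c)) = edge_mat m (map (map_prod q' q') L)"
  proof (rule eq_matI)
    fix r c
    assume "r < dim_row (edge_mat m (map (map_prod q' q') L))"
      "c < dim_col (edge_mat m (map (map_prod q' q') L))"
    then have r: "r < length L" and c: "c < m"
      by auto
    have "q c = u \<longleftrightarrow> c = q' u" if "u < m" for u
      using that inv[OF c] q' by metis
    then show "mat (length L) m (\<lambda>(r, c). edge_mat m L $$ (r, q c)) $$ (r, c) =
        edge_mat m (map (map_prod q' q') L) $$ (r, c)"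
      using r c qm[OF c] edge_ends[OF r] by (simp add: index_edge_mat)
  qed auto
qed

lemma A_perm_edge_mat:
  assumes "n > 0" "p permutes {1..n\<^sup>2}"
  obtains L cls where "A_perm n p = edge_mat (n\<^sup>2) L" "length L = n * s_sum n"
    "block_tournament L (n\<^sup>2) n cls"
proof -
  let ?L = "block_pairs n n"
  \<comment> \<open>These are the inverse permutation and the permutation itself, moved from
    \<open>{1..n\<^sup>2}\<close> to indices counted from 0.\<close>
  define q where "q c = inv_into UNIV p (Suc c) - 1" for c
  define q' where "q' c = p (Suc c) - 1" for c
  interpret block_tournament ?L "n\<^sup>2" n "\<lambda>c. c div n"
    using block_tournament_block_pairs[OF assms(1), of n] by (simp add: power2_eq_square)
  have p_inv: "inv_into UNIV p permutes {1..n\<^sup>2}"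
    using assms(2) by (rule permutes_inv)
  have range: "p (Suc c) \<in> {1..n\<^sup>2}" "inv_into UNIV p (Suc c) \<in> {1..n\<^sup>2}" if "c < n\<^sup>2" for c
    using that permutes_in_image[OF assms(2), of "Suc c"] permutes_in_image[OF p_inv, of "Suc c"]
    by auto
  have qq': "q (q' c) = c \<and> q' c < n\<^sup>2" "q' (q c) = c \<and> q c < n\<^sup>2" if "c < n\<^sup>2" for c
    using range[OF that] permutes_inverses[OF assms(2)] by (auto simp: q_def q'_def)
  have bij: "bij_betw q {..<n\<^sup>2} {..<n\<^sup>2}"
    by (rule bij_betw_byWitness[where f' = q']) (use qq' in auto)
  have A: "A_mat n = edge_mat (n\<^sup>2) ?L"
    by (simp add: A_mat_def A_blk_eq_edge_mat diag_block_edge_mat power2_eq_square)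
  have "A_perm n p = mat (length ?L) (n\<^sup>2) (\<lambda>(r, c). edge_mat (n\<^sup>2) ?L $$ (r, q c))"
  proof (rule eq_matI)
    fix r c
    assume "r < dim_row (mat (length ?L) (n\<^sup>2) (\<lambda>(r, c). edge_mat (n\<^sup>2) ?L $$ (r, q c)))"
      "c < dim_col (mat (length ?L) (n\<^sup>2) (\<lambda>(r, c). edge_mat (n\<^sup>2) ?L $$ (r, q c)))"
    then have rc: "r < n * s_sum n" "c < n\<^sup>2"
      by (auto simp: length_block_pairs)
    then show "A_perm n p $$ (r, c) =
        mat (length ?L) (n\<^sup>2) (\<lambda>(r, c). edge_mat (n\<^sup>2) ?L $$ (r, q c)) $$ (r, c)"
      using qq'(2)[of c]
      by (simp add: A_perm_def A mat_of_cols_def length_block_pairs q_def del: upt_Suc)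
  qed (auto simp: A_perm_def length_block_pairs simp del: upt_Suc)
  also have "\<dots> = edge_mat (n\<^sup>2) (map (map_prod q' q') ?L)"
    using bij qq'(1) by (rule relabel(2))
  finally have "A_perm n p = edge_mat (n\<^sup>2) (map (map_prod q' q') ?L)" .
  moreover have "block_tournament (map (map_prod q' q') ?L) (n\<^sup>2) n ((\<lambda>c. c div n) \<circ> q)"
    using bij qq'(1) by (rule relabel(1))
  ultimately show thesis
    using that by (simp add: length_block_pairs)
qed

section \<open>The equality constraints\<close>

lemma A_eq_carrier: "A_eq n k i \<in> carrier_mat k (n\<^sup>2)"
  by (rule carrier_matI) (simp_all add: A_eq_def del: upt_Suc)

lemma A_eq_mult_vec:
  assumes "i ` {1..k} \<subseteq> {1..n\<^sup>2}" "x \<in> carrier_vec (n\<^sup>2)" "l < k"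
  shows "(A_eq n k i *\<^sub>v x) $ l = x $ (i (Suc l) - 1)"
proof -
  have "i (Suc l) \<in> {1..n\<^sup>2}"
    by (rule subsetD[OF assms(1)], rule imageI) (use assms(3) in simp)
  then have "i (Suc l) - 1 < n\<^sup>2"
    unfolding atLeastAtMost_iff by linarith
  then show ?thesis
    using assms(2,3) by (simp add: A_eq_def del: upt_Suc)
qed

text \<open>Rows of \<open>A_eq\<close> are unit vectors, so the constant n + 1 passes unchanged
  into each entry and matches the right-hand side of the dual constraint.\<close>

lemma A_eq_mult_vec_affine:
  assumes "i ` {1..k} \<subseteq> {1..n\<^sup>2}" "x \<in> carrier_vec (n\<^sup>2)" "z \<in> carrier_vec (n\<^sup>2)"
    and "\<And>c. c < n\<^sup>2 \<Longrightarrow> z $ c = 2 * x $ c - (real n + 1)"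
  shows "A_eq n k i *\<^sub>v z = 2 \<cdot>\<^sub>v g_vec k i g - (real n + 1) \<cdot>\<^sub>v ones k \<longleftrightarrow>
    A_eq n k i *\<^sub>v x = g_vec k i g"
proof -
  have dims: "dim_vec (A_eq n k i *\<^sub>v y) = k" "dim_vec (g_vec k i g) = k" "dim_vec (ones k) = k" for y
    by (simp_all add: A_eq_def g_vec_def ones_def del: upt_Suc)
  have "(A_eq n k i *\<^sub>v z) $ l = 2 * (A_eq n k i *\<^sub>v x) $ l - (real n + 1)" if "l < k" for l
  proof -
    have "i (Suc l) \<in> {1..n\<^sup>2}"
      by (rule subsetD[OF assms(1)], rule imageI) (use that in simp)
    then have "i (Suc l) - 1 < n\<^sup>2"
      unfolding atLeastAtMost_iff by linarith
    then show ?thesis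
      unfolding A_eq_mult_vec[OF assms(1,2) that] A_eq_mult_vec[OF assms(1,3) that] by (rule assms(4))
  qed
  moreover have "(2 \<cdot>\<^sub>v g_vec k i g - (real n + 1) \<cdot>\<^sub>v ones k) $ l = 2 * g_vec k i g $ l - (real n + 1)"
    if "l < k" for l
    using that dims by (simp add: ones_def)
  ultimately have entry: "(A_eq n k i *\<^sub>v z) $ l = (2 \<cdot>\<^sub>v g_vec k i g - (real n + 1) \<cdot>\<^sub>v ones k) $ l \<longleftrightarrow>
      (A_eq n k i *\<^sub>v x) $ l = g_vec k i g $ l" if "l < k" for l
    using that by (simp only:) linarith
  have dim: "dim_vec (2 \<cdot>\<^sub>v g_vec k i g - (real n + 1) \<cdot>\<^sub>v ones k) = k"
    by (simp add: dims)
  show ?thesis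
    unfolding vec_eq_iff dims dim by (simp only: entry simp_thms cong: imp_cong)
qed

section \<open>Passing between the primal and the dual problem\<close>

theorem theorem3p1:
  fixes n k :: nat and \<pi> :: "nat \<Rightarrow> nat \<Rightarrow> nat" and i :: "nat \<Rightarrow> nat" and g :: "nat \<Rightarrow> int"
  assumes "n \<ge> 2"
    and "\<forall>r \<in> {1, 2, 3}. \<pi> r permutes {1..n\<^sup>2}"
    and "k \<le> n\<^sup>2"
    and "inj_on i {1..k}"
    and "i ` {1..k} \<subseteq> {1..n\<^sup>2}"
    and "\<forall>l \<in> {1..k}. 1 \<le> g (i l) \<and> g (i l) \<le> int n"
  shows "(\<forall>x. solves_PP n \<pi> k i g x \<longrightarrow>
            solves_DP n \<pi> k i g (map_vec sgn (A_perm n (\<pi> 1) *\<^sub>v x))) \<and>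
         (\<forall>lam. solves_DP n \<pi> k i g lam \<longrightarrow>
            solves_PP n \<pi> k i g
              ((1/2) \<cdot>\<^sub>v ((A_perm n (\<pi> 1))\<^sup>T *\<^sub>v lam + (real n + 1) \<cdot>\<^sub>v ones (n\<^sup>2))))"
proof -
  let ?m = "n\<^sup>2" and ?R = "n * s_sum n"
  let ?A = "\<lambda>r. A_perm n (\<pi> r)"
  have n: "n > 0"
    using assms(1) by simp
  have carr: "?A r \<in> carrier_mat ?R ?m" for r
    by (rule carrier_matI) (simp_all add: A_perm_def del: upt_Suc)
  \<comment> \<open>The edge list depends on the permutation, but for each one the rows sum to zero,
    so z = 2x - (n + 1) and x satisfy the same nonvanishing condition.\<close>
  have aff: "no_zero_entry (?A r *\<^sub>v z) \<longleftrightarrow> no_zero_entry (?A r *\<^sub>v x)"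
    if "r \<in> {1, 2, 3}" "x \<in> carrier_vec ?m" "z \<in> carrier_vec ?m"
      "\<And>c. c < ?m \<Longrightarrow> z $ c = 2 * x $ c - (real n + 1)" for r x z
  proof -
    have "\<pi> r permutes {1..?m}"
      using assms(2) that(1) by blast
    then obtain L cls where A: "?A r = edge_mat ?m L" and "block_tournament L ?m n cls"
      using A_perm_edge_mat[OF n] by blast
    then have "set L \<subseteq> {..<?m} \<times> {..<?m}"
      by (intro block_tournament.edges_subset)
    then show ?thesis
      unfolding A using that
      by (intro no_zero_entry_edge_mat_affine[where \<alpha> = 2 and \<beta> = "- (real n + 1)"]) simp_all
  qed
  have assoc: "(B * (?A 1)\<^sup>T) *\<^sub>v lam = B *\<^sub>v ((?A 1)\<^sup>T *\<^sub>v lam)"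
    if "B \<in> carrier_mat d ?m" "lam \<in> carrier_vec ?R" for B d and lam :: "real vec"
    by (rule assoc_mult_mat_vec[OF that(1) transpose_carrier_mat[THEN iffD2, OF carr] that(2)])
  have transpose_carr: "(?A 1)\<^sup>T *\<^sub>v lam \<in> carrier_vec ?m" for lam :: "real vec"
    by (rule carrier_vecI) (simp add: carrier_matD[OF carr])
  have "\<pi> 1 permutes {1..?m}"
    using assms(2) by blast
  then obtain L cls where A1: "?A 1 = edge_mat ?m L" and len: "length L = ?R"
    and "block_tournament L ?m n cls"
    using A_perm_edge_mat[OF n] by blast
  then interpret block_tournament L ?m n cls
    by simp
  \<comment> \<open>Both directions now reduce to the entrywise link between the transposed product
    and 2x - (n + 1), together with the bounds or signs of the entries.\<close>
  have transfer: "(\<forall>r \<in> {1, 2, 3}. no_zero_entry ((?A r * (?A 1)\<^sup>T) *\<^sub>v lam)) \<and>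
      (A_eq n k i * (?A 1)\<^sup>T) *\<^sub>v lam = 2 \<cdot>\<^sub>v g_vec k i g - (real n + 1) \<cdot>\<^sub>v ones k \<longleftrightarrow>
      (\<forall>r \<in> {1, 2, 3}. no_zero_entry (?A r *\<^sub>v x)) \<and> A_eq n k i *\<^sub>v x = g_vec k i g"
    if "lam \<in> carrier_vec ?R" "x \<in> carrier_vec ?m"
      "\<And>c. c < ?m \<Longrightarrow> ((?A 1)\<^sup>T *\<^sub>v lam) $ c = 2 * x $ c - (real n + 1)" for lam x
    using aff[OF _ that(2) transpose_carr that(3)] assoc[OF carr that(1)]
      assoc[OF A_eq_carrier that(1)] A_eq_mult_vec_affine[OF assms(5) that(2) transpose_carr that(3)]
    by simp
  show ?thesis
  proof (intro conjI allI impI)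
    fix x assume PP: "solves_PP n \<pi> k i g x"
    define lam where "lam = map_vec sgn (?A 1 *\<^sub>v x)"
    have x: "x \<in> carrier_vec ?m" and nz: "no_zero_entry (?A 1 *\<^sub>v x)"
      using PP by (auto simp: solves_PP_def)
    have lam: "lam \<in> carrier_vec ?R"
      unfolding lam_def by (rule carrier_vecI) (simp add: carrier_matD[OF carr])
    have "\<forall>j < ?R. lam $ j \<in> {-1, 1}"
      using nz carr[of 1] by (auto simp: lam_def no_zero_entry_def sgn_if)
    moreover have "((?A 1)\<^sup>T *\<^sub>v lam) $ c = 2 * x $ c - (real n + 1)" if "c < ?m" for c
      \<comment> \<open>For a primal solution the link is the counting result on
        tournaments.\<close>
      unfolding lam_def A1
      by (rule transpose_mult_sgn) (use PP that nz A1 in \<open>auto simp: solves_PP_def\<close>)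
    ultimately show "solves_DP n \<pi> k i g (map_vec sgn (?A 1 *\<^sub>v x))"
      unfolding lam_def[symmetric] using PP transfer[OF lam x] lam
      by (simp add: solves_PP_def solves_DP_def)
  next
    fix lam assume DP: "solves_DP n \<pi> k i g lam"
    define x where "x = (1/2) \<cdot>\<^sub>v ((?A 1)\<^sup>T *\<^sub>v lam + (real n + 1) \<cdot>\<^sub>v ones ?m)"
    have lam: "lam \<in> carrier_vec ?R"
      using DP by (simp add: solves_DP_def)
    have x: "x \<in> carrier_vec ?m"
      unfolding x_def by (rule carrier_vecI) (simp add: ones_def)
    \<comment> \<open>For a dual solution the link holds by the definition of \<open>x\<close>; what
      remains is integrality and the bounds.\<close>
    have eq: "((?A 1)\<^sup>T *\<^sub>v lam) $ c = 2 * x $ c - (real n + 1)" if "c < ?m" for c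
      using that transpose_carr[of lam] by (simp add: x_def ones_def field_simps del: index_mult_mat_vec)
    have "x $ c \<in> \<int> \<and> 1 \<le> x $ c \<and> x $ c \<le> real n" if "c < ?m" for c
    proof -
      have "\<exists>t < n. ((?A 1)\<^sup>T *\<^sub>v lam) $ c = 2 * real t + 1 - real n"
        unfolding A1
      proof (rule transpose_mult_signs[OF _ _ that])
        show "lam \<in> carrier_vec (length L)"
          using lam by (simp only: len)
        show "lam $ r \<in> {-1, 1}" if "r < length L" for r
          using DP that unfolding solves_DP_def len by blast
      qed
      then obtain t where t: "t < n" "((?A 1)\<^sup>T *\<^sub>v lam) $ c = 2 * real t + 1 - real n"
        by blast
      \<comment> \<open>Halving (2t + 1 - n) + (n + 1) gives t + 1, and t < n places it in
        \<open>{1..n}\<close>.\<close>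
      then have "x $ c = real (Suc t)"
        using eq[OF that] by simp
      then show ?thesis
        using t(1) by (simp only: Ints_of_nat) simp
    qed
    then show "solves_PP n \<pi> k i g ((1/2) \<cdot>\<^sub>v ((?A 1)\<^sup>T *\<^sub>v lam + (real n + 1) \<cdot>\<^sub>v ones ?m))"
      unfolding x_def[symmetric] using DP transfer[OF lam x eq] x
      by (simp add: solves_PP_def solves_DP_def)
  qed
qed

end
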